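(* For each $L\ge 2$, let $R_L$ be the set of principal roots of all incomplete PLRS's generated by $L$ coefficients. Then for every $\varepsilon>0$ there exists an $M$ such that for all $L>M$ and for every $\varepsilon$-ball (open interval of radius $\varepsilon$) $B_\varepsilon\subset(1,2)$, we have $B_\varepsilon\cap R_L\neq\varnothing$.
   Context: A positive linear recurrence sequence (PLRS) generated by $[c_1,\ldots,c_L]$, where $L\ge 1$, the $c_i$ are nonnegative integers, $c_1\ge 1$ and $c_L\ge 1$, is the sequence of positive integers $(H_n)_{n\ge1}$ with $H_1=1$, $H_{n+1}=c_1H_n+c_2H_{n-1}+\cdots+c_nH_1+1$ for $1\le n<L$, and $H_{n+1}=c_1H_n+\cdots+c_LH_{n+1-L}$ for $n\ge L$. A sequence of positive integers $(a_i)_{i\ge1}$ is complete if every positive integer $n$ can be written as $n=\sum_{i=1}^\infty \varepsilon_i a_i$ with $\varepsilon_i\in\{0,1\}$; otherwise it is incomplete. The principal root of the PLRS is the unique positive real root of its characteristic polynomial $x^L-\sum_{i=1}^L c_i x^{L-i}$ (this polynomial has exactly one positive root). *)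

theory Defs
  imports "HOL-Analysis.Analysis" "HOL-Computational_Algebra.Polynomial"
begin

text \<open>
  The generating coefficients \<open>[c\<^sub>1, \<dots>, c\<^sub>L]\<close> are a list \<open>cs\<close> of length \<open>L\<close>; lists are indexed
  from 0, so \<open>c\<^sub>i\<close> is \<open>cs ! (i - 1)\<close>.
\<close>

definition plrs_coeffs :: "nat list \<Rightarrow> bool" where
  "plrs_coeffs cs \<longleftrightarrow> length cs \<ge> 1 \<and> hd cs \<ge> 1 \<and> last cs \<ge> 1"

text \<open>The sequence starts at index 1; the value at index 0 is a dummy that is never used.\<close>

fun plrs :: "nat list \<Rightarrow> nat \<Rightarrow> nat" where
  "plrs cs 0 = 0"
| "plrs cs (Suc 0) = 1"
| "plrs cs (Suc (Suc m)) =
     (let n = Suc m in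
      if n < length cs
      then (\<Sum>i = 1..Suc m. cs ! (i - 1) * plrs cs (Suc (Suc m) - i)) + 1
      else (\<Sum>i = 1..length cs. cs ! (i - 1) * plrs cs (Suc (Suc m) - i)))"

text \<open>
  For a sequence \<open>a\<^sub>1, a\<^sub>2, \<dots>\<close>; the series is over the discrete space of naturals, and it is shifted
  because \<^const>\<open>sums\<close> starts at index 0.
\<close>

definition complete_seq :: "(nat \<Rightarrow> nat) \<Rightarrow> bool" where
  "complete_seq a \<longleftrightarrow>
     (\<forall>n\<ge>1. \<exists>e :: nat \<Rightarrow> nat. (\<forall>i\<ge>1. e i \<in> {0, 1}) \<and>
        (\<lambda>i. e (Suc i) * a (Suc i)) sums n)"

definition plrs_char_poly :: "nat list \<Rightarrow> real poly" where
  "plrs_char_poly cs =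
     monom 1 (length cs) -
     (\<Sum>i = 1..length cs. monom (real (cs ! (i - 1))) (length cs - i))"

definition principal_root :: "nat list \<Rightarrow> real" where
  "principal_root cs = (THE x. x > 0 \<and> poly (plrs_char_poly cs) x = 0)"

definition incomplete_roots :: "nat \<Rightarrow> real set" where
  "incomplete_roots L =
     {principal_root cs | cs.
        length cs = L \<and> plrs_coeffs cs \<and> \<not> complete_seq (plrs cs)}"

lemma plrs_initial:
  assumes "1 \<le> n" "n < length cs"
  shows "plrs cs (n + 1) = (\<Sum>i = 1..n. cs ! (i - 1) * plrs cs (n + 1 - i)) + 1"
proof -
  obtain m where "n = Suc m" using assms by (cases n) auto
  then show ?thesis using assms by (simp add: Let_def)
qed

lemma plrs_recurrence:
  assumes "plrs_coeffs cs" "length cs \<le> n"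
  shows "plrs cs (n + 1) = (\<Sum>i = 1..length cs. cs ! (i - 1) * plrs cs (n + 1 - i))"
proof -
  obtain m where "n = Suc m" using assms by (cases n) (auto simp: plrs_coeffs_def)
  then show ?thesis using assms by (simp add: Let_def)
qed

lemma ex1_principal_root:
  assumes "plrs_coeffs cs"
  shows "\<exists>!x. x > 0 \<and> poly (plrs_char_poly cs) x = 0"
proof -
  define L where "L = length cs"
  define f where "f x = (\<Sum>i = 1..L. real (cs ! (i - 1)) / x ^ i)" for x :: real
  have L: "1 \<le> L" and c1: "cs ! 0 \<ge> 1"
    using assms by (auto simp: plrs_coeffs_def L_def hd_conv_nth Suc_le_eq)
  have p: "poly (plrs_char_poly cs) x = x ^ L * (1 - f x)" if "x > 0" for x
  proof -
    have "x ^ L * f x = (\<Sum>i = 1..L. real (cs ! (i - 1)) * x ^ (L - i))"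
      unfolding f_def sum_distrib_left
      using that by (intro sum.cong refl) (auto simp: power_diff)
    then show ?thesis
      by (simp add: plrs_char_poly_def poly_sum poly_monom L_def algebra_simps)
  qed
  have iff: "poly (plrs_char_poly cs) x = 0 \<longleftrightarrow> f x = 1" if "x > 0" for x
    using p[OF that] that by auto
  have dec: "f y < f x" if "0 < x" "x < y" for x y
    unfolding f_def
  proof (rule sum_strict_mono_ex1)
    show "\<forall>i\<in>{1..L}. real (cs ! (i - 1)) / y ^ i \<le> real (cs ! (i - 1)) / x ^ i"
      using that by (auto intro!: divide_left_mono power_mono mult_pos_pos)
    show "\<exists>i\<in>{1..L}. real (cs ! (i - 1)) / y ^ i < real (cs ! (i - 1)) / x ^ i"
      using that L c1 by (intro bexI[of _ 1]) (auto intro!: divide_strict_left_mono)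
  qed simp
  define S where "S = 1 + (\<Sum>i = 1..L. real (cs ! (i - 1)))"
  have S1: "S \<ge> 1" by (auto simp: S_def intro!: sum_nonneg)
  have "f 1 \<ge> 1"
  proof -
    have "real (cs ! (1 - 1)) \<le> (\<Sum>i = 1..L. real (cs ! (i - 1)))"
      using L by (intro member_le_sum) auto
    then show ?thesis using c1 by (simp add: f_def)
  qed
  moreover have "f S \<le> 1"
  proof -
    have "f S \<le> (\<Sum>i = 1..L. real (cs ! (i - 1)) / S)"
      unfolding f_def
    proof (rule sum_mono)
      fix i assume "i \<in> {1..L}"
      then have "S ^ 1 \<le> S ^ i" using S1 by (intro power_increasing) auto
      then show "real (cs ! (i - 1)) / S ^ i \<le> real (cs ! (i - 1)) / S"
        using S1 by (intro divide_left_mono) auto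
    qed
    also have "\<dots> = (S - 1) / S" by (simp add: S_def sum_divide_distrib)
    also have "\<dots> \<le> 1" using S1 by simp
    finally show ?thesis .
  qed
  moreover have "continuous_on {1..S} f"
    unfolding f_def by (intro continuous_intros) auto
  ultimately obtain x where x: "1 \<le> x" "f x = 1"
    using IVT2'[of f S 1 1] S1 by auto
  show ?thesis
  proof (rule ex1I[of _ x])
    show "x > 0 \<and> poly (plrs_char_poly cs) x = 0" using x iff[of x] by auto
  next
    fix y assume y: "y > 0 \<and> poly (plrs_char_poly cs) y = 0"
    then have "f y = 1" using iff by auto
    then show "y = x" using dec[of x y] dec[of y x] x y by (cases x y rule: linorder_cases) auto
  qed
qed

end

theory Submission
  imports Defs "HOL-Real_Asymp.Real_Asymp"
begin

text \<open>
  The coefficients \<open>[1, 0, \<dots>, 0, N]\<close> already suffice. Their sequence starts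
  \<open>1, 2, \<dots>, L, L + N\<close>, so for \<open>N \<ge> L\<^sup>2\<close> the number \<open>1 + (1 + \<dots> + L)\<close> is skipped. The principal
  root solves \<open>x\<^sup>L\<^sup>-\<^sup>1 (x - 1) = N\<close>, and on an interval inside \<open>(1, 2)\<close> bounded away from \<open>1\<close> the
  left-hand side is exponentially large in \<open>L\<close> and grows by more than \<open>1\<close> over any fixed length,
  so that some integer \<open>N \<ge> L\<^sup>2\<close> is attained there.
\<close>

text \<open>The number just above the sum of the first \<open>m\<close> terms cannot be represented:
  any later term alone overshoots it, and the first \<open>m\<close> terms together fall short by
  one.\<close>

lemma not_complete_seq_gap:
  assumes gap: "\<And>i. i > m \<Longrightarrow> a i > 1 + (\<Sum>j=1..m. a j)"
  shows "\<not> complete_seq a"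
proof
  assume "complete_seq a"
  define n where "n = 1 + (\<Sum>j=1..m. a j)"
  obtain e where e: "\<And>i. i \<ge> 1 \<Longrightarrow> e i \<in> {0, 1}"
    and s: "(\<lambda>i. e (Suc i) * a (Suc i)) sums n"
    using \<open>complete_seq a\<close> unfolding complete_seq_def n_def by (metis le_add1)
  have zero: "e (Suc i) = 0" if "i \<ge> m" for i
  proof (rule ccontr)
    assume "e (Suc i) \<noteq> 0"
    then have "a (Suc i) = (\<Sum>j\<in>{i}. e (Suc j) * a (Suc j))"
      using e[of "Suc i"] by simp
    also have "\<dots> \<le> (\<Sum>j. e (Suc j) * a (Suc j))"
      using s by (intro sum_le_suminf) (auto simp: sums_iff)
    also have "\<dots> = n" using s by (simp add: sums_iff)
    finally show False using gap[of "Suc i"] that by (simp add: n_def)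
  qed
  have "(\<lambda>i. e (Suc i) * a (Suc i)) sums (\<Sum>i<m. e (Suc i) * a (Suc i))"
    by (rule sums_finite) (auto simp: zero)
  then have "n = (\<Sum>i<m. e (Suc i) * a (Suc i))" using s sums_unique2 by blast
  also have "\<dots> \<le> (\<Sum>i<m. a (Suc i))"
  proof (rule sum_mono)
    show "e (Suc i) * a (Suc i) \<le> a (Suc i)" for i using e[of "Suc i"] by auto
  qed
  also have "\<dots> = (\<Sum>j=1..m. a j)" by (simp add: sum.atLeast1_atMost_eq)
  finally show False by (simp add: n_def)
qed

text \<open>\<open>k\<close> counts the inner zeros, so the length \<open>k + 2\<close> runs through
  all L \<ge> 2 without a side condition.\<close>

definition two_term_coeffs :: "nat \<Rightarrow> nat \<Rightarrow> nat list" where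
  "two_term_coeffs k N = 1 # replicate k 0 @ [N]"

lemma length_two_term_coeffs [simp]: "length (two_term_coeffs k N) = k + 2"
  by (simp add: two_term_coeffs_def)

lemma plrs_coeffs_two_term_coeffs: "N \<ge> 1 \<Longrightarrow> plrs_coeffs (two_term_coeffs k N)"
  by (simp add: two_term_coeffs_def plrs_coeffs_def)

lemma nth_two_term_coeffs:
  "i < k + 2 \<Longrightarrow> two_term_coeffs k N ! i = (if i = 0 then 1 else if i = k + 1 then N else 0)"
  by (auto simp: two_term_coeffs_def nth_Cons nth_append split: nat.split)

text \<open>The sum stops before the last coefficient, so only the leading 1 survives. The semiring
  is generic to cover both the recurrence over \<open>nat\<close> and the real characteristic
  polynomial.\<close>

lemma sum_two_term_coeffs_less:
  fixes f :: "nat \<Rightarrow> 'a::semiring_1"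
  assumes "1 \<le> m" "m \<le> k + 1"
  shows "(\<Sum>i=1..m. of_nat (two_term_coeffs k N ! (i - 1)) * f i) = f 1"
proof -
  have "(\<Sum>i=1..m. of_nat (two_term_coeffs k N ! (i - 1)) * f i)
      = (\<Sum>i\<in>{1}. of_nat (two_term_coeffs k N ! (i - 1)) * f i)"
    using assms by (intro sum.mono_neutral_right) (auto simp: nth_two_term_coeffs split: if_splits)
  then show ?thesis by (simp add: nth_two_term_coeffs)
qed

lemma sum_two_term_coeffs:
  fixes f :: "nat \<Rightarrow> 'a::semiring_1"
  shows "(\<Sum>i=1..k+2. of_nat (two_term_coeffs k N ! (i - 1)) * f i) = f 1 + of_nat N * f (k + 2)"
proof -
  have "(\<Sum>i=1..k+2. of_nat (two_term_coeffs k N ! (i - 1)) * f i)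
      = (\<Sum>i=1..k+1. of_nat (two_term_coeffs k N ! (i - 1)) * f i) + of_nat N * f (k + 2)"
    by (simp add: nth_two_term_coeffs)
  then show ?thesis using sum_two_term_coeffs_less[of "k + 1" k N f] by simp
qed

lemma plrs_two_term_coeffs_initial:
  "1 \<le> n \<Longrightarrow> n \<le> k + 2 \<Longrightarrow> plrs (two_term_coeffs k N) n = n"
proof (induction n rule: dec_induct)
  case (step n)
  then show ?case
    using plrs_initial[of n "two_term_coeffs k N"]
      sum_two_term_coeffs_less[of n k N "\<lambda>i. plrs (two_term_coeffs k N) (n + 1 - i)"]
    by simp
qed simp

lemma plrs_two_term_coeffs_recurrence:
  assumes "N \<ge> 1" "n \<ge> k + 2"
  shows "plrs (two_term_coeffs k N) (n + 1)
    = plrs (two_term_coeffs k N) n + N * plrs (two_term_coeffs k N) (n - (k + 1))"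
  using plrs_recurrence[OF plrs_coeffs_two_term_coeffs[OF assms(1)], of k n] assms
    sum_two_term_coeffs[of k N "\<lambda>i. plrs (two_term_coeffs k N) (n + 1 - i)"]
  by simp

lemma not_complete_plrs_two_term_coeffs:
  assumes "N \<ge> (k + 2)\<^sup>2"
  shows "\<not> complete_seq (plrs (two_term_coeffs k N))"
proof (rule not_complete_seq_gap[where m = "k + 2"])
  let ?a = "plrs (two_term_coeffs k N)"
  have N: "N \<ge> 1"
  proof -
    have "1 \<le> (k + 2)\<^sup>2" by simp
    then show ?thesis using assms by linarith
  qed
  \<comment> \<open>The recurrence only adds nonnegative amounts, so the bound at index
    \<open>k + 3\<close> persists.\<close>
  have ge: "?a i \<ge> k + 2 + N" if "i \<ge> k + 3" for i
    using that
  proof (induction i rule: dec_induct)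
    case base
    \<comment> \<open>Here the recurrence reaches back exactly to index 1, where the value is 1,
      which gives \<open>(k + 2) + N * 1\<close>.\<close>
    show ?case
      using plrs_two_term_coeffs_recurrence[OF N, of k "k + 2"]
        plrs_two_term_coeffs_initial[of "k + 2" k N] plrs_two_term_coeffs_initial[of 1 k N]
      by (simp add: eval_nat_numeral)
  next
    case (step i)
    then show ?case using plrs_two_term_coeffs_recurrence[OF N, of k i] by simp
  qed
  have "(\<Sum>j=1..k+2. ?a j) = (\<Sum>j=1..k+2. j)"
    by (rule sum.cong) (auto simp: plrs_two_term_coeffs_initial)
  also have "2 * \<dots> = (k + 2) * (k + 3)"
    using double_gauss_sum_from_Suc_0[of "k + 2", where 'a = nat] by (simp add: algebra_simps)
  finally have "2 * (\<Sum>j=1..k+2. ?a j) = (k + 2) * (k + 3)" .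
  moreover have "(k + 2) * (k + 3) = (k + 2)\<^sup>2 + (k + 2)" by (simp add: power2_eq_square algebra_simps)
  moreover have "(k + 2)\<^sup>2 \<ge> 4" by (simp add: power2_eq_square)
  ultimately have "1 + (\<Sum>j=1..k+2. ?a j) < k + 2 + N" using assms by linarith
  then show "?a i > 1 + (\<Sum>j=1..k+2. ?a j)" if "i > k + 2" for i
    using ge[of i] that by linarith
qed

lemma poly_plrs_char_poly_two_term_coeffs:
  "poly (plrs_char_poly (two_term_coeffs k N)) x = x ^ (k + 1) * (x - 1) - real N"
  using sum_two_term_coeffs[of k N "\<lambda>i. x ^ (k + 2 - i)"]
  by (simp add: plrs_char_poly_def poly_sum poly_monom algebra_simps)

lemma principal_root_two_term_coeffs:
  assumes "N \<ge> 1" "x > 0" "x ^ (k + 1) * (x - 1) = real N"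
  shows "principal_root (two_term_coeffs k N) = x"
  unfolding principal_root_def
  using assms(2,3)
  by (intro the1_equality ex1_principal_root plrs_coeffs_two_term_coeffs[OF assms(1)])
    (simp add: poly_plrs_char_poly_two_term_coeffs)

text \<open>The hypothesis \<open>large\<close> is used twice: it puts the value at \<open>x\<close>
  above \<open>(k + 2)\<^sup>2\<close>, which forces incompleteness, and it makes the increase up to
  \<open>x + \<delta>\<close> at least 1, so that an integer value is attained.\<close>

lemma incomplete_root_in_interval:
  assumes \<delta>: "\<delta> > 0" and x: "x \<ge> 1 + \<delta>"
    and large: "(1 + \<delta>) ^ (k + 1) * \<delta> \<ge> (real k + 2)\<^sup>2 + 1"
  shows "\<exists>y\<in>{x..x+\<delta>}. y \<in> incomplete_roots (k + 2)"
proof -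
  define g where "g y = y ^ (k + 1) * (y - 1)" for y :: real
  \<comment> \<open>The least integer not below \<open>g x\<close>; as \<open>g x\<close> turns out
    nonnegative, \<open>nat\<close> does not truncate.\<close>
  define N where "N = nat \<lceil>g x\<rceil>"
  have pow: "(1 + \<delta>) ^ (k + 1) \<le> x ^ (k + 1)" using \<delta> x by (intro power_mono) auto
  have x0: "x ^ (k + 1) \<ge> 0" using \<delta> x by (intro zero_le_power) auto
  have "(1 + \<delta>) ^ (k + 1) * \<delta> \<le> g x"
    unfolding g_def using \<delta> x x0 by (intro mult_mono pow) auto
  then have gx: "(real k + 2)\<^sup>2 + 1 \<le> g x" using large by linarith
  have g0: "g x \<ge> 0" using gx by (smt (verit) zero_le_power2)
  have N: "g x \<le> real N" "real N \<le> g x + 1" using g0 by (auto simp: N_def; linarith)+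
  \<comment> \<open>Raising the factor \<open>x - 1\<close> by \<open>\<delta>\<close> while keeping
    the power fixed already gains at least 1.\<close>
  have "g x + 1 \<le> x ^ (k + 1) * (x - 1) + (1 + \<delta>) ^ (k + 1) * \<delta>"
    using large by (smt (verit) g_def zero_le_power2)
  also have "\<dots> \<le> x ^ (k + 1) * (x - 1) + x ^ (k + 1) * \<delta>"
    using pow \<delta> by (intro add_left_mono mult_right_mono) auto
  also have "\<dots> = x ^ (k + 1) * (x + \<delta> - 1)" by (simp add: algebra_simps)
  also have "\<dots> \<le> g (x + \<delta>)"
    unfolding g_def using \<delta> x by (intro mult_right_mono power_mono) auto
  finally have "real N \<le> g (x + \<delta>)" using N by linarith
  moreover have "continuous_on {x..x+\<delta>} g" unfolding g_def by (intro continuous_intros)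
  ultimately obtain y where y: "x \<le> y" "y \<le> x + \<delta>" "g y = real N"
    using IVT'[of g x "real N" "x + \<delta>"] N \<delta> by auto
  have "real ((k + 2)\<^sup>2) = (real k + 2)\<^sup>2" by simp
  then have "real ((k + 2)\<^sup>2) \<le> real N" using gx N(1) by linarith
  then have sq: "(k + 2)\<^sup>2 \<le> N" by (simp only: of_nat_le_iff)
  have N1: "N \<ge> 1" using sq by (cases N) auto
  have "principal_root (two_term_coeffs k N) = y"
    using y x \<delta> N1 by (intro principal_root_two_term_coeffs) (auto simp: g_def)
  then have "y \<in> incomplete_roots (k + 2)"
    unfolding incomplete_roots_def
    using not_complete_plrs_two_term_coeffs[OF sq] plrs_coeffs_two_term_coeffs[OF N1]
    by (auto intro!: exI[of _ "two_term_coeffs k N"])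
  then show ?thesis using y by auto
qed

theorem theorem4p23:
  shows "\<forall>\<epsilon>::real. \<epsilon> > 0 \<longrightarrow>
           (\<exists>M::nat. \<forall>L::nat. L \<ge> 2 \<and> L > M \<longrightarrow>
              (\<forall>x::real. ball x \<epsilon> \<subseteq> {1<..<2} \<longrightarrow> ball x \<epsilon> \<inter> incomplete_roots L \<noteq> {}))"
proof (intro allI impI)
  fix \<epsilon> :: real
  assume "\<epsilon> > 0"
  \<comment> \<open>Half the radius keeps both \<open>x - \<delta>\<close> and
    \<open>x + \<delta>\<close> inside the open ball; the former lies above 1, so \<open>x\<close>
    stays away from 1 by an amount depending only on \<open>\<epsilon>\<close>.\<close>
  define \<delta> where "\<delta> = \<epsilon> / 2"
  have \<delta>: "\<delta> > 0" using \<open>\<epsilon> > 0\<close> by (simp add: \<delta>_def)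
  \<comment> \<open>An exponential with base above 1 beats a quadratic. The threshold depends on
    \<open>\<delta>\<close> alone, hence is uniform in the centre \<open>x\<close>.\<close>
  have "eventually (\<lambda>k::nat. (1 + \<delta>) ^ (k + 1) * \<delta> \<ge> (real k + 2)\<^sup>2 + 1) sequentially"
    using \<delta> by real_asymp
  then obtain K where K: "\<And>k. k \<ge> K \<Longrightarrow> (1 + \<delta>) ^ (k + 1) * \<delta> \<ge> (real k + 2)\<^sup>2 + 1"
    by (auto simp: eventually_sequentially)
  show "\<exists>M::nat. \<forall>L::nat. L \<ge> 2 \<and> L > M \<longrightarrow>
          (\<forall>x::real. ball x \<epsilon> \<subseteq> {1<..<2} \<longrightarrow> ball x \<epsilon> \<inter> incomplete_roots L \<noteq> {})"
  proof (intro exI[of _ "K + 2"] allI impI)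
    fix L :: nat and x :: real
    assume L: "L \<ge> 2 \<and> L > K + 2" and ball: "ball x \<epsilon> \<subseteq> {1<..<2}"
    have "x - \<delta> \<in> ball x \<epsilon>" using \<delta> by (simp add: dist_real_def \<delta>_def)
    then have "x - \<delta> \<in> {1<..<2}" using ball by blast
    then have "x \<ge> 1 + \<delta>" by simp
    moreover have "K \<le> L - 2" using L by linarith
    ultimately obtain y where "y \<in> {x..x+\<delta>}" "y \<in> incomplete_roots (L - 2 + 2)"
      using incomplete_root_in_interval[OF \<delta> _ K, of x "L - 2"] by blast
    moreover have "L - 2 + 2 = L" using L by linarith
    moreover have "y \<in> ball x \<epsilon>"
      using \<open>y \<in> {x..x+\<delta>}\<close> \<open>\<epsilon> > 0\<close> by (auto simp: dist_real_def \<delta>_def)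
    ultimately show "ball x \<epsilon> \<inter> incomplete_roots L \<noteq> {}" by auto
  qed
qed

end
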